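(* The category $\mathbf{ZHaus}$ of zero-dimensional Hausdorff spaces and continuous maps and the category $\mathbf{dzBoole}$ of Boolean dz-algebras are dually equivalent.
   Context: Boolean algebras with $0=1$ are allowed. $\mathbf{Boole}$ is the category of Boolean algebras and Boolean homomorphisms; $\mathbf{2}=\{0,1\}$ is the two-element Boolean algebra ($0\neq 1$); $\mathbf{Boole}(A,\mathbf 2)$ is the set of Boolean homomorphisms $A\to\mathbf 2$. $\mathbf{ZHaus}$ is the category of all zero-dimensional Hausdorff spaces (Hausdorff spaces having a base of clopen sets) and all continuous maps. $\mathrm{CO}(X)$ is the set of clopen subsets of a space $X$. For a Boolean algebra $A$ and $a\in A$, put $s_A(a)=\{x\in \mathbf{Boole}(A,\mathbf 2)\mid x(a)=1\}$; the Stone space $\mathsf S(A)$ is $\mathbf{Boole}(A,\mathbf 2)$ with the topology having $\{s_A(a)\mid a\in A\}$ as a base. For $X\subseteq \mathbf{Boole}(A,\mathbf 2)$ put $s_A^X(a)=X\cap s_A(a)$. A Boolean z-algebra is a pair $(A,X)$, where $A$ is a Boolean algebra and $X\subseteq\mathbf{Boole}(A,\mathbf 2)$, such that for each $a\in A\setminus\{0\}$ there is $x\in X$ with $x(a)=1$. A Boolean dz-algebra is a Boolean z-algebra $(A,X)$ such that $s_A^X(A)=\mathrm{CO}(X)$, where $X$ carries the subspace topology from $\mathsf S(A)$. $\mathbf{dzBoole}$ is the category whose objects are all Boolean dz-algebras and whose morphisms $(A,X)\to(A',X')$ are all pairs $(\varphi,f)$ with $\varphi:A\to A'$ a Boolean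 homomorphism and $f:X'\to X$ a function such that $x'\circ\varphi=f(x')$ for every $x'\in X'$. Composition is $(\varphi',f')\circ(\varphi,f)=(\varphi'\circ\varphi,f\circ f')$ and the identity of $(A,X)$ is $(id_A,id_X)$. Two categories are dually equivalent if there are contravariant functors between them in both directions whose two composites are naturally isomorphic to the identity functors. *)

theory Defs
  imports "HOL-Analysis.Analysis" "HOL-Library.Equipollence" "HOL-Library.FuncSet"
begin

section \<open>Categories and dual equivalence\<close>

text \<open>
  Morphisms do not carry their domain and codomain, so identities, composition and the
  morphism part of a functor are indexed by the objects involved:
  \<open>cmp C X Y Z g f\<close> is the composite of \<open>f : X \<rightarrow> Y\<close> and \<open>g : Y \<rightarrow> Z\<close>.
\<close>

record ('o, 'm) cat =
  obj :: "'o set"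
  hom :: "'o \<Rightarrow> 'o \<Rightarrow> 'm set"
  ident :: "'o \<Rightarrow> 'm"
  cmp :: "'o \<Rightarrow> 'o \<Rightarrow> 'o \<Rightarrow> 'm \<Rightarrow> 'm \<Rightarrow> 'm"

locale category =
  fixes C :: "('o, 'm) cat"
  assumes ident_in_hom: "X \<in> obj C \<Longrightarrow> ident C X \<in> hom C X X"
    and comp_in_hom: "\<lbrakk>X \<in> obj C; Y \<in> obj C; Z \<in> obj C; f \<in> hom C X Y; g \<in> hom C Y Z\<rbrakk>
      \<Longrightarrow> cmp C X Y Z g f \<in> hom C X Z"
    and comp_ident_right: "\<lbrakk>X \<in> obj C; Y \<in> obj C; f \<in> hom C X Y\<rbrakk>
      \<Longrightarrow> cmp C X X Y f (ident C X) = f"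
    and comp_ident_left: "\<lbrakk>X \<in> obj C; Y \<in> obj C; f \<in> hom C X Y\<rbrakk>
      \<Longrightarrow> cmp C X Y Y (ident C Y) f = f"
    and comp_assoc: "\<lbrakk>W \<in> obj C; X \<in> obj C; Y \<in> obj C; Z \<in> obj C;
        f \<in> hom C W X; g \<in> hom C X Y; h \<in> hom C Y Z\<rbrakk>
      \<Longrightarrow> cmp C W Y Z h (cmp C W X Y g f) = cmp C W X Z (cmp C X Y Z h g) f"

record ('o, 'm, 'p, 'n) functr =
  on_obj :: "'o \<Rightarrow> 'p"
  on_hom :: "'o \<Rightarrow> 'o \<Rightarrow> 'm \<Rightarrow> 'n"

locale contravariant_functor =
  fixes C :: "('o, 'm) cat" and D :: "('p, 'n) cat" and F :: "('o, 'm, 'p, 'n) functr"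
  assumes on_obj_in: "X \<in> obj C \<Longrightarrow> on_obj F X \<in> obj D"
    and on_hom_in: "\<lbrakk>X \<in> obj C; Y \<in> obj C; f \<in> hom C X Y\<rbrakk>
      \<Longrightarrow> on_hom F X Y f \<in> hom D (on_obj F Y) (on_obj F X)"
    and on_hom_ident: "X \<in> obj C \<Longrightarrow> on_hom F X X (ident C X) = ident D (on_obj F X)"
    and on_hom_comp: "\<lbrakk>X \<in> obj C; Y \<in> obj C; Z \<in> obj C; f \<in> hom C X Y; g \<in> hom C Y Z\<rbrakk>
      \<Longrightarrow> on_hom F X Z (cmp C X Y Z g f) =
        cmp D (on_obj F Z) (on_obj F Y) (on_obj F X) (on_hom F X Y f) (on_hom F Y Z g)"

definition id_functor :: "('o, 'm, 'o, 'm) functr" where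
  "id_functor = \<lparr>on_obj = (\<lambda>X. X), on_hom = (\<lambda>X Y f. f)\<rparr>"

text \<open>The composite of two contravariant functors, first \<open>F\<close>, then \<open>G\<close>; it is covariant.\<close>

definition contra_comp ::
  "('p, 'n, 'q, 'k) functr \<Rightarrow> ('o, 'm, 'p, 'n) functr \<Rightarrow> ('o, 'm, 'q, 'k) functr" where
  "contra_comp G F =
    \<lparr>on_obj = (\<lambda>X. on_obj G (on_obj F X)),
     on_hom = (\<lambda>X Y f. on_hom G (on_obj F Y) (on_obj F X) (on_hom F X Y f))\<rparr>"

definition iso_in :: "('o, 'm) cat \<Rightarrow> 'o \<Rightarrow> 'o \<Rightarrow> 'm \<Rightarrow> bool" where
  "iso_in C X Y f \<longleftrightarrow> f \<in> hom C X Y \<and>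
    (\<exists>g\<in>hom C Y X. cmp C X Y X g f = ident C X \<and> cmp C Y X Y f g = ident C Y)"

definition naturally_isomorphic ::
  "('o, 'm) cat \<Rightarrow> ('p, 'n) cat \<Rightarrow> ('o, 'm, 'p, 'n) functr \<Rightarrow> ('o, 'm, 'p, 'n) functr \<Rightarrow> bool" where
  "naturally_isomorphic C D F G \<longleftrightarrow>
    (\<exists>\<eta>. (\<forall>X\<in>obj C. iso_in D (on_obj F X) (on_obj G X) (\<eta> X)) \<and>
      (\<forall>X\<in>obj C. \<forall>Y\<in>obj C. \<forall>f\<in>hom C X Y.
        cmp D (on_obj F X) (on_obj F Y) (on_obj G Y) (\<eta> Y) (on_hom F X Y f) =
        cmp D (on_obj F X) (on_obj G X) (on_obj G Y) (on_hom G X Y f) (\<eta> X)))"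

definition dually_equivalent :: "('o, 'm) cat \<Rightarrow> ('p, 'n) cat \<Rightarrow> bool" where
  "dually_equivalent C D \<longleftrightarrow> category C \<and> category D \<and>
    (\<exists>F G. contravariant_functor C D F \<and> contravariant_functor D C G \<and>
      naturally_isomorphic C C (contra_comp G F) id_functor \<and>
      naturally_isomorphic D D (contra_comp F G) id_functor)"

section \<open>Size bounds\<close>

text \<open>
  There is no type of all topological spaces. A category of ``all'' spaces therefore consists of
  spaces whose points come from a fixed type and whose size is bounded: \<open>small U S\<close> says that \<open>S\<close>
  is no larger than some member of \<open>U\<close>. The bound \<open>U = UNIV\<close> on sets over \<open>'p\<close> admits every space
  with points in \<open>'p\<close>; if \<open>U\<close> consists of the small sets of a universe, then the \<open>U\<close>-small spaces
  are obtained.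
\<close>

definition small :: "'p set set \<Rightarrow> 'x set \<Rightarrow> bool" where
  "small U S \<longleftrightarrow> (\<exists>T\<in>U. S \<lesssim> T)"

section \<open>Zero-dimensional Hausdorff spaces\<close>

definition CO :: "'p topology \<Rightarrow> 'p set set" where
  "CO X = {V. openin X V \<and> closedin X V}"

definition zero_dimensional_Hausdorff :: "'p topology \<Rightarrow> bool" where
  "zero_dimensional_Hausdorff X \<longleftrightarrow> Hausdorff_space X \<and>
    (\<exists>B. B \<subseteq> CO X \<and> openin X = arbitrary union_of (\<lambda>V. V \<in> B))"

definition ZHaus :: "'p set set \<Rightarrow> ('p topology, 'p \<Rightarrow> 'p) cat" where
  "ZHaus U =
    \<lparr>obj = {X. zero_dimensional_Hausdorff X \<and> small U (topspace X)},
     hom = (\<lambda>X Y. {f \<in> extensional (topspace X). continuous_map X Y f}),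
     ident = (\<lambda>X. restrict id (topspace X)),
     cmp = (\<lambda>X Y Z g f. compose (topspace X) g f)\<rparr>"

section \<open>Boolean algebras\<close>

record 'a balg =
  carr :: "'a set"
  conj :: "'a \<Rightarrow> 'a \<Rightarrow> 'a"
  disj :: "'a \<Rightarrow> 'a \<Rightarrow> 'a"
  compl :: "'a \<Rightarrow> 'a"
  zero :: "'a"
  one :: "'a"

text \<open>
  The axioms of the library's \<^locale>\<open>abstract_boolean_algebra\<close>, relativised to a carrier;
  \<open>zero A = one A\<close> is not excluded.
\<close>

locale bool_alg =
  fixes A :: "'a balg"
  assumes conj_closed: "\<lbrakk>x \<in> carr A; y \<in> carr A\<rbrakk> \<Longrightarrow> conj A x y \<in> carr A"
    and disj_closed: "\<lbrakk>x \<in> carr A; y \<in> carr A\<rbrakk> \<Longrightarrow> disj A x y \<in> carr A"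
    and compl_closed: "x \<in> carr A \<Longrightarrow> compl A x \<in> carr A"
    and zero_closed: "zero A \<in> carr A"
    and one_closed: "one A \<in> carr A"
    and conj_assoc: "\<lbrakk>x \<in> carr A; y \<in> carr A; z \<in> carr A\<rbrakk>
      \<Longrightarrow> conj A (conj A x y) z = conj A x (conj A y z)"
    and conj_commute: "\<lbrakk>x \<in> carr A; y \<in> carr A\<rbrakk> \<Longrightarrow> conj A x y = conj A y x"
    and disj_assoc: "\<lbrakk>x \<in> carr A; y \<in> carr A; z \<in> carr A\<rbrakk>
      \<Longrightarrow> disj A (disj A x y) z = disj A x (disj A y z)"
    and disj_commute: "\<lbrakk>x \<in> carr A; y \<in> carr A\<rbrakk> \<Longrightarrow> disj A x y = disj A y x"
    and conj_disj_distrib: "\<lbrakk>x \<in> carr A; y \<in> carr A; z \<in> carr A\<rbrakk>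
      \<Longrightarrow> conj A x (disj A y z) = disj A (conj A x y) (conj A x z)"
    and disj_conj_distrib: "\<lbrakk>x \<in> carr A; y \<in> carr A; z \<in> carr A\<rbrakk>
      \<Longrightarrow> disj A x (conj A y z) = conj A (disj A x y) (disj A x z)"
    and conj_one_right: "x \<in> carr A \<Longrightarrow> conj A x (one A) = x"
    and disj_zero_right: "x \<in> carr A \<Longrightarrow> disj A x (zero A) = x"
    and conj_cancel_right: "x \<in> carr A \<Longrightarrow> conj A x (compl A x) = zero A"
    and disj_cancel_right: "x \<in> carr A \<Longrightarrow> disj A x (compl A x) = one A"

definition Boole :: "'a balg \<Rightarrow> 'b balg \<Rightarrow> ('a \<Rightarrow> 'b) set" where
  "Boole A B = {\<phi> \<in> carr A \<rightarrow>\<^sub>E carr B.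
    (\<forall>x\<in>carr A. \<forall>y\<in>carr A. \<phi> (conj A x y) = conj B (\<phi> x) (\<phi> y)) \<and>
    (\<forall>x\<in>carr A. \<forall>y\<in>carr A. \<phi> (disj A x y) = disj B (\<phi> x) (\<phi> y)) \<and>
    (\<forall>x\<in>carr A. \<phi> (compl A x) = compl B (\<phi> x)) \<and>
    \<phi> (zero A) = zero B \<and> \<phi> (one A) = one B}"

definition two :: "bool balg" where
  "two = \<lparr>carr = UNIV, conj = (\<and>), disj = (\<or>), compl = Not, zero = False, one = True\<rparr>"

section \<open>Stone spaces and Boolean dz-algebras\<close>

definition stone_set :: "'a balg \<Rightarrow> 'a \<Rightarrow> ('a \<Rightarrow> bool) set" where
  "stone_set A a = {x \<in> Boole A two. x a = one two}"

definition stone_space :: "'a balg \<Rightarrow> ('a \<Rightarrow> bool) topology" where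
  "stone_space A = topology (arbitrary union_of (\<lambda>V. V \<in> stone_set A ` carr A))"

type_synonym 'a zalg = "'a balg \<times> ('a \<Rightarrow> bool) set"

definition z_algebra :: "'a zalg \<Rightarrow> bool" where
  "z_algebra = (\<lambda>(A, X). bool_alg A \<and> X \<subseteq> Boole A two \<and>
    (\<forall>a\<in>carr A - {zero A}. \<exists>x\<in>X. x a = one two))"

definition dz_algebra :: "'a zalg \<Rightarrow> bool" where
  "dz_algebra = (\<lambda>(A, X). z_algebra (A, X) \<and>
    (\<lambda>a. X \<inter> stone_set A a) ` carr A = CO (subtopology (stone_space A) X))"

text \<open>
  The size bound is imposed on \<open>X\<close>, which corresponds to the point set of a space. It also bounds
  \<open>A\<close>, because in a z-algebra \<open>a \<mapsto> X \<inter> stone_set A a\<close> embeds \<open>A\<close> into the power set of \<open>X\<close>.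
  Conversely, \<open>Pow T \<lesssim> (UNIV :: 'a set)\<close> for \<open>T \<in> U\<close> says that \<open>'a\<close> has room for a copy of
  \<open>CO X\<close> for every space \<open>X\<close> bounded by \<open>U\<close>.
\<close>

definition dzBoole :: "'p set set \<Rightarrow> ('a zalg, ('a \<Rightarrow> 'a) \<times> (('a \<Rightarrow> bool) \<Rightarrow> ('a \<Rightarrow> bool))) cat" where
  "dzBoole U =
    \<lparr>obj = {(A, X). dz_algebra (A, X) \<and> small U X},
     hom = (\<lambda>(A, X) (A', X'). {(\<phi>, f). \<phi> \<in> Boole A A' \<and> f \<in> X' \<rightarrow>\<^sub>E X \<and>
       (\<forall>x'\<in>X'. compose (carr A) x' \<phi> = f x')}),
     ident = (\<lambda>(A, X). (restrict id (carr A), restrict id X)),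
     cmp = (\<lambda>(A, X) (A', X') (A'', X'') (\<phi>', f') (\<phi>, f).
       (compose (carr A) \<phi>' \<phi>, compose X'' f f'))\<rparr>"

section \<open>The definitions are well-formed\<close>

lemma bool_alg_two: "bool_alg two"
  by unfold_locales (auto simp: two_def)

lemma openin_stone_space:
  assumes "bool_alg A"
  shows "openin (stone_space A) = arbitrary union_of (\<lambda>V. V \<in> stone_set A ` carr A)"
proof -
  interpret bool_alg A by fact
  have "stone_set A a \<inter> stone_set A b = stone_set A (conj A a b)"
    if "a \<in> carr A" "b \<in> carr A" for a b
    using that by (auto simp: stone_set_def Boole_def two_def)
  then have "istopology (arbitrary union_of (\<lambda>V. V \<in> stone_set A ` carr A))"
    by (intro istopology_base) (auto simp: conj_closed)
  then show ?thesis
    by (simp add: stone_space_def)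
qed

lemma topspace_stone_space:
  assumes "bool_alg A"
  shows "topspace (stone_space A) = Boole A two"
proof
  have 1: "stone_set A (one A) = Boole A two"
    by (auto simp: stone_set_def Boole_def)
  have "stone_set A (one A) \<in> stone_set A ` carr A"
    using assms by (simp add: bool_alg.one_closed)
  then have "openin (stone_space A) (Boole A two)"
    unfolding openin_stone_space [OF assms] 1 [symmetric] by (rule arbitrary_union_of_inc)
  then show "Boole A two \<subseteq> topspace (stone_space A)"
    by (rule openin_subset)
  have "openin (stone_space A) (topspace (stone_space A))" by simp
  then show "topspace (stone_space A) \<subseteq> Boole A two"
    unfolding openin_stone_space [OF assms]
    by (auto simp: union_of_def arbitrary_def stone_set_def)
qed

lemma category_ZHaus: "category (ZHaus U)"
proof
  fix X Y Z :: "'a topology" and f g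
  assume "f \<in> hom (ZHaus U) X Y" "g \<in> hom (ZHaus U) Y Z"
  then have "continuous_map X Z (g \<circ> f)"
    by (auto simp: ZHaus_def intro: continuous_map_compose)
  then have "continuous_map X Z (compose (topspace X) g f)"
    by (rule continuous_map_eq) (simp add: compose_def)
  then show "cmp (ZHaus U) X Y Z g f \<in> hom (ZHaus U) X Z"
    by (simp add: ZHaus_def)
next
  fix X :: "'a topology"
  have "continuous_map X X (restrict id (topspace X))"
    by (rule continuous_map_eq [OF continuous_map_id]) simp
  then show "ident (ZHaus U) X \<in> hom (ZHaus U) X X"
    by (simp add: ZHaus_def)
qed (auto simp: ZHaus_def compose_def extensional_def restrict_def fun_eq_iff continuous_map_def
    Pi_iff)

lemma Boole_compose:
  assumes "bool_alg A" "\<phi> \<in> Boole A B" "\<psi> \<in> Boole B D"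
  shows "compose (carr A) \<psi> \<phi> \<in> Boole A D"
proof -
  interpret bool_alg A by fact
  show ?thesis
    using assms(2,3) unfolding Boole_def
    by (auto simp: compose_def conj_closed disj_closed compl_closed zero_closed one_closed PiE_iff)
qed

lemma Boole_id:
  assumes "bool_alg A"
  shows "restrict id (carr A) \<in> Boole A A"
proof -
  interpret bool_alg A by fact
  show ?thesis
    by (auto simp: Boole_def conj_closed disj_closed compl_closed zero_closed one_closed)
qed

lemma compose_restrict_id:
  assumes "f \<in> S \<rightarrow>\<^sub>E T"
  shows "compose S f (restrict id S) = f" "compose S (restrict id T) f = f"
  using assms by (auto simp: compose_def restrict_def PiE_iff extensional_def)

lemma category_dzBoole: "category (dzBoole U)"
proof
  fix M :: "'a zalg"
  assume "M \<in> obj (dzBoole U)"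
  then obtain A X where M: "M = (A, X)" "bool_alg A" "X \<subseteq> Boole A two"
    by (auto simp: dzBoole_def dz_algebra_def z_algebra_def)
  have "compose (carr A) x (restrict id (carr A)) = x" if "x \<in> X" for x
    using that M(3) by (auto simp: compose_def Boole_def PiE_iff extensional_def fun_eq_iff)
  then show "ident (dzBoole U) M \<in> hom (dzBoole U) M M"
    using Boole_id [OF M(2)] by (auto simp: dzBoole_def M(1))
next
  fix M N P :: "'a zalg" and F G
  assume "M \<in> obj (dzBoole U)" "F \<in> hom (dzBoole U) M N" "G \<in> hom (dzBoole U) N P"
  moreover obtain A X A' X' A'' X'' \<phi> f \<psi> g where
    eqs: "M = (A, X)" "N = (A', X')" "P = (A'', X'')" "F = (\<phi>, f)" "G = (\<psi>, g)"
    by (metis surj_pair)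
  ultimately have A: "bool_alg A" and \<phi>: "\<phi> \<in> Boole A A'" and f: "f \<in> X' \<rightarrow>\<^sub>E X"
    and \<psi>: "\<psi> \<in> Boole A' A''" and g: "g \<in> X'' \<rightarrow>\<^sub>E X'"
    and cf: "\<forall>x\<in>X'. compose (carr A) x \<phi> = f x"
    and cg: "\<forall>x\<in>X''. compose (carr A') x \<psi> = g x"
    by (auto simp: dzBoole_def dz_algebra_def z_algebra_def)
  have "compose (carr A) x (compose (carr A) \<psi> \<phi>) = compose X'' f g x" if x: "x \<in> X''" for x
  proof -
    have "compose (carr A) x (compose (carr A) \<psi> \<phi>) = compose (carr A) (compose (carr A') x \<psi>) \<phi>"
      using \<phi> by (intro compose_assoc) (auto simp: Boole_def)
    also have "\<dots> = f (g x)"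
      using cf cg g x by auto
    finally show ?thesis using x by (simp add: compose_def)
  qed
  then show "cmp (dzBoole U) M N P G F \<in> hom (dzBoole U) M P"
    using Boole_compose [OF A \<phi> \<psi>] f g by (auto simp: dzBoole_def eqs compose_def PiE_iff)
next
  fix M N :: "'a zalg" and F
  assume F: "F \<in> hom (dzBoole U) M N"
  obtain A X A' X' \<phi> f where eqs: "M = (A, X)" "N = (A', X')" "F = (\<phi>, f)"
    by (metis surj_pair)
  have *: "\<phi> \<in> carr A \<rightarrow>\<^sub>E carr A'" "f \<in> X' \<rightarrow>\<^sub>E X"
    using F by (auto simp: dzBoole_def Boole_def eqs)
  then have "compose (carr A) \<phi> (restrict id (carr A)) = \<phi>" "compose X' (restrict id X) f = f"
    "compose (carr A) (restrict id (carr A')) \<phi> = \<phi>" "compose X' f (restrict id X') = f"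
    by (simp_all add: compose_restrict_id)
  then show "cmp (dzBoole U) M M N F (ident (dzBoole U) M) = F"
    "cmp (dzBoole U) M N N (ident (dzBoole U) N) F = F"
    by (simp_all add: dzBoole_def eqs)
next
  fix M N P Q :: "'a zalg" and F G H
  assume *: "F \<in> hom (dzBoole U) M N" "G \<in> hom (dzBoole U) N P" "H \<in> hom (dzBoole U) P Q"
  obtain A X A' X' A'' X'' B Y \<phi> f \<psi> g \<theta> h where
    eqs: "M = (A, X)" "N = (A', X')" "P = (A'', X'')" "Q = (B, Y)"
      "F = (\<phi>, f)" "G = (\<psi>, g)" "H = (\<theta>, h)"
    by (metis surj_pair)
  have "\<phi> \<in> carr A \<rightarrow> carr A'" "h \<in> Y \<rightarrow> X''"
    using * by (auto simp: dzBoole_def Boole_def eqs)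
  then have "compose (carr A) \<theta> (compose (carr A) \<psi> \<phi>) = compose (carr A) (compose (carr A') \<theta> \<psi>) \<phi>"
    "compose Y f (compose Y g h) = compose Y (compose X'' f g) h"
    by (simp_all add: compose_assoc)
  then show "cmp (dzBoole U) M P Q H (cmp (dzBoole U) M N P G F) =
      cmp (dzBoole U) M N Q (cmp (dzBoole U) N P Q H G) F"
    by (simp add: dzBoole_def eqs)
qed

end

theory Submission
  imports Defs
begin

text \<open>
  A dz-algebra \<open>(A, X)\<close> is sent to the set \<open>X\<close> with the topology induced by the Stone space,
  and \<open>(\<phi>, f)\<close> to \<open>f\<close>. This functor is faithful because the points of \<open>X'\<close> separate the elements of
  \<open>A'\<close>, so \<open>f\<close> determines \<open>\<phi>\<close>; it is full because the preimage of the clopen set of \<open>a\<close> under a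
  continuous \<open>f\<close> is clopen, hence the clopen set of a unique element \<open>\<phi> a\<close>. A zero-dimensional
  Hausdorff space is homeomorphic to its points regarded as two-valued homomorphisms on its clopen
  algebra, so the functor is essentially surjective. A fully faithful and essentially surjective
  contravariant functor is a dual equivalence.
\<close>

section \<open>Fully faithful and essentially surjective functors\<close>

lemma dually_equivalent_sym: "dually_equivalent C D \<Longrightarrow> dually_equivalent D C"
  unfolding dually_equivalent_def by blast

text \<open>Essential surjectivity provides for each \<open>Y\<close> in \<open>D\<close> an object
  \<open>G Y\<close> of \<open>C\<close> and an isomorphism \<open>e Y\<close> from
  \<open>?F (G Y)\<close> to \<open>Y\<close>. Conjugating a morphism of \<open>D\<close> by these
  isomorphisms and lifting the result through the bijections on hom sets makes \<open>G\<close> a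
  contravariant functor; \<open>e\<close> and the lifts of its inverses are the two natural
  isomorphisms.\<close>

lemma dually_equivalent_if_fully_faithful:
  fixes C :: "('o, 'm) cat" and D :: "('q, 'n) cat"
  assumes C: "category C" and D: "category D" and F: "contravariant_functor C D F"
    and bij: "\<And>X Y. \<lbrakk>X \<in> obj C; Y \<in> obj C\<rbrakk>
      \<Longrightarrow> bij_betw (on_hom F X Y) (hom C X Y) (hom D (on_obj F Y) (on_obj F X))"
    and ess: "\<And>Y. Y \<in> obj D \<Longrightarrow> \<exists>X\<in>obj C. \<exists>e. iso_in D (on_obj F X) Y e"
  shows "dually_equivalent C D"
proof -
  interpret C: category C by fact
  interpret D: category D by fact
  interpret F: contravariant_functor C D F by fact
  let ?F = "on_obj F" and ?FH = "on_hom F"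
  from ess obtain G where G: "\<And>Y. Y \<in> obj D \<Longrightarrow> G Y \<in> obj C \<and> (\<exists>e. iso_in D (?F (G Y)) Y e)"
    by metis
  then have Gobj: "\<And>Y. Y \<in> obj D \<Longrightarrow> G Y \<in> obj C" by blast
  from G obtain e where e: "\<And>Y. Y \<in> obj D \<Longrightarrow> iso_in D (?F (G Y)) Y (e Y)"
    by metis
  then have "\<And>Y. Y \<in> obj D \<Longrightarrow> \<exists>g. g \<in> hom D Y (?F (G Y)) \<and>
      cmp D (?F (G Y)) Y (?F (G Y)) g (e Y) = ident D (?F (G Y)) \<and>
      cmp D Y (?F (G Y)) Y (e Y) g = ident D Y"
    unfolding iso_in_def by blast
  then obtain e' where e': "\<And>Y. Y \<in> obj D \<Longrightarrow> e' Y \<in> hom D Y (?F (G Y))"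
      "\<And>Y. Y \<in> obj D \<Longrightarrow> cmp D (?F (G Y)) Y (?F (G Y)) (e' Y) (e Y) = ident D (?F (G Y))"
      "\<And>Y. Y \<in> obj D \<Longrightarrow> cmp D Y (?F (G Y)) Y (e Y) (e' Y) = ident D Y"
    by metis
  have e_hom: "\<And>Y. Y \<in> obj D \<Longrightarrow> e Y \<in> hom D (?F (G Y)) Y"
    using e by (simp add: iso_in_def)
  have e_cancel: "cmp D Y (?F (G Z)) Z (e Z) (cmp D Y Z (?F (G Z)) (e' Z) k) = k"
    "cmp D Y Z (?F (G Z)) (e' Z) (cmp D Y (?F (G Z)) Z (e Z) l) = l"
    if "Y \<in> obj D" "Z \<in> obj D" "k \<in> hom D Y Z" "l \<in> hom D Y (?F (G Z))" for Y Z k l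
    using that e' e_hom Gobj F.on_obj_in
    by (metis D.comp_assoc D.comp_ident_left)+
  \<comment> \<open>The inverse of the bijection on hom sets: a morphism of \<open>D\<close> between
    images of \<open>F\<close> becomes a morphism of \<open>C\<close> pointing the other
    way.\<close>
  define P where "P X Y k = the_inv_into (hom C X Y) (?FH X Y) k" for X Y k
  have P: "P X Y k \<in> hom C X Y" "?FH X Y (P X Y k) = k"
    if "X \<in> obj C" "Y \<in> obj C" "k \<in> hom D (?F Y) (?F X)" for X Y k
    using bij [OF that(1,2)] that(3) unfolding P_def
    by (auto simp: bij_betw_def the_inv_into_into f_the_inv_into_f)
  \<comment> \<open>Faithfulness: an equation in \<open>C\<close> may be checked after applying
    \<open>F\<close>.\<close>
  have eqI: "f = g" if "?FH X Y f = ?FH X Y g" "X \<in> obj C" "Y \<in> obj C"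
      "f \<in> hom C X Y" "g \<in> hom C X Y" for X Y f g
    using bij [OF that(2,3)] that by (auto simp: bij_betw_def inj_on_def)
  \<comment> \<open>The morphism \<open>h\<close> transported to the image of \<open>F\<close>,
    along \<open>?F (G Y)\<close> to \<open>Y\<close> to \<open>Z\<close> to
    \<open>?F (G Z)\<close>.\<close>
  define K where "K Y Z h = cmp D (?F (G Y)) Z (?F (G Z)) (e' Z) (cmp D (?F (G Y)) Y Z h (e Y))"
    for Y Z h
  have K: "K Y Z h \<in> hom D (?F (G Y)) (?F (G Z))"
    if "Y \<in> obj D" "Z \<in> obj D" "h \<in> hom D Y Z" for Y Z h
    unfolding K_def using that
    by (intro D.comp_in_hom [of _ Z] D.comp_in_hom [of _ Y] e' e_hom Gobj F.on_obj_in)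
  \<comment> \<open>Cancelling \<open>e Z\<close> against \<open>e' Z\<close> gives naturality of
    \<open>e\<close>; cancelling \<open>e Y\<close> against \<open>e' Y\<close> gives that of
    \<open>e'\<close> in \<open>K_nat'\<close>.\<close>
  have K_nat: "cmp D (?F (G Y)) (?F (G Z)) Z (e Z) (K Y Z h) = cmp D (?F (G Y)) Y Z h (e Y)"
    if "Y \<in> obj D" "Z \<in> obj D" "h \<in> hom D Y Z" for Y Z h
    unfolding K_def using that
    by (intro e_cancel D.comp_in_hom [of _ Y] e' e_hom Gobj F.on_obj_in)
      (auto intro!: K Gobj F.on_obj_in)
  have K_nat': "cmp D Y (?F (G Y)) (?F (G Z)) (K Y Z h) (e' Y) = cmp D Y Z (?F (G Z)) (e' Z) h"
    if "Y \<in> obj D" "Z \<in> obj D" "h \<in> hom D Y Z" for Y Z h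
  proof -
    note in_objs = Gobj F.on_obj_in that
    have "cmp D Y (?F (G Y)) (?F (G Z)) (K Y Z h) (e' Y)
      = cmp D Y Z (?F (G Z)) (e' Z) (cmp D Y (?F (G Y)) Z (cmp D (?F (G Y)) Y Z h (e Y)) (e' Y))"
      unfolding K_def
      by (rule D.comp_assoc [symmetric]) (use in_objs in \<open>auto intro!: e' e_hom intro: D.comp_in_hom [of _ Y]\<close>)
    also have "cmp D Y (?F (G Y)) Z (cmp D (?F (G Y)) Y Z h (e Y)) (e' Y)
      = cmp D Y Y Z h (cmp D Y (?F (G Y)) Y (e Y) (e' Y))"
      by (rule D.comp_assoc [symmetric]) (use in_objs in \<open>auto intro!: e' e_hom\<close>)
    also have "\<dots> = h"
      using that by (simp add: e' D.comp_ident_right)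
    finally show ?thesis .
  qed

  \<comment> \<open>The functor from \<open>D\<close> back to \<open>C\<close>\<close>
  define GF where "GF = \<lparr>on_obj = G, on_hom = (\<lambda>Y Z h. P (G Z) (G Y) (K Y Z h))\<rparr>"
  have GF_simps [simp]: "on_obj GF = G" "on_hom GF Y Z h = P (G Z) (G Y) (K Y Z h)" for Y Z h
    by (simp_all add: GF_def)
  have GF: "contravariant_functor D C GF"
  proof
    fix Y assume Y: "Y \<in> obj D"
    then show "on_obj GF Y \<in> obj C" by (simp add: Gobj)
    have "K Y Y (ident D Y) = ident D (?F (G Y))"
      using Y by (simp add: K_def D.comp_ident_left e_hom e' Gobj F.on_obj_in)
    then have "?FH (G Y) (G Y) (P (G Y) (G Y) (K Y Y (ident D Y))) = ?FH (G Y) (G Y) (ident C (G Y))"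
      using Y by (simp add: P Gobj F.on_hom_ident F.on_obj_in D.ident_in_hom)
    then show "on_hom GF Y Y (ident D Y) = ident C (on_obj GF Y)"
      using Y by (auto intro!: eqI [of "G Y" "G Y"] P K Gobj C.ident_in_hom D.ident_in_hom)
  next
    fix X Y f assume "X \<in> obj D" "Y \<in> obj D" "f \<in> hom D X Y"
    then show "on_hom GF X Y f \<in> hom C (on_obj GF Y) (on_obj GF X)"
      by (simp add: P K Gobj)
  next
    fix X Y Z f g
    assume XYZ: "X \<in> obj D" "Y \<in> obj D" "Z \<in> obj D" and f: "f \<in> hom D X Y" and g: "g \<in> hom D Y Z"
    note facts = XYZ f g Gobj F.on_obj_in e' e_hom K
    have gf: "cmp D X Y Z g f \<in> hom D X Z"
      using XYZ f g by (intro D.comp_in_hom)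
    have fe: "cmp D (?F (G X)) X Y f (e X) \<in> hom D (?F (G X)) Y"
      by (rule D.comp_in_hom) (use facts in auto)
    have ge: "cmp D (?F (G Y)) Y Z g (e Y) \<in> hom D (?F (G Y)) Z"
      by (rule D.comp_in_hom) (use facts in auto)
    \<comment> \<open>Once the brackets are moved, the inner pair \<open>e Y\<close>,
      \<open>e' Y\<close> cancels, so conjugation preserves composition. The reversal of order comes
      from lifting through the contravariant \<open>F\<close>.\<close>
    have "cmp D (?F (G X)) (?F (G Y)) (?F (G Z)) (K Y Z g) (K X Y f)
      = cmp D (?F (G X)) Z (?F (G Z)) (e' Z)
         (cmp D (?F (G X)) (?F (G Y)) Z (cmp D (?F (G Y)) Y Z g (e Y)) (K X Y f))"
      unfolding K_def [of Y Z] by (rule D.comp_assoc [symmetric]) (use facts ge in auto)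
    also have "cmp D (?F (G X)) (?F (G Y)) Z (cmp D (?F (G Y)) Y Z g (e Y)) (K X Y f)
      = cmp D (?F (G X)) Y Z g (cmp D (?F (G X)) (?F (G Y)) Y (e Y) (K X Y f))"
      by (rule D.comp_assoc [symmetric]) (use facts in auto)
    also have "\<dots> = cmp D (?F (G X)) Y Z g (cmp D (?F (G X)) X Y f (e X))"
      using XYZ f by (simp add: K_nat)
    also have "\<dots> = cmp D (?F (G X)) X Z (cmp D X Y Z g f) (e X)"
      by (rule D.comp_assoc) (use facts in auto)
    finally have K_comp: "K X Z (cmp D X Y Z g f)
        = cmp D (?F (G X)) (?F (G Y)) (?F (G Z)) (K Y Z g) (K X Y f)"
      by (simp add: K_def)
    show "on_hom GF X Z (cmp D X Y Z g f) =
      cmp C (on_obj GF Z) (on_obj GF Y) (on_obj GF X) (on_hom GF X Y f) (on_hom GF Y Z g)"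
      unfolding GF_simps
    proof (rule eqI)
      show "?FH (G Z) (G X) (P (G Z) (G X) (K X Z (cmp D X Y Z g f))) =
        ?FH (G Z) (G X) (cmp C (G Z) (G Y) (G X) (P (G Y) (G X) (K X Y f)) (P (G Z) (G Y) (K Y Z g)))"
        using facts gf by (simp add: F.on_hom_comp P K_comp [symmetric])
      show "cmp C (G Z) (G Y) (G X) (P (G Y) (G X) (K X Y f)) (P (G Z) (G Y) (K Y Z g)) \<in> hom C (G Z) (G X)"
        by (rule C.comp_in_hom) (use facts P in auto)
    qed (use facts gf P in auto)
  qed

  \<comment> \<open>Counit and unit\<close>
  have counit: "naturally_isomorphic D D (contra_comp F GF) id_functor"
    unfolding naturally_isomorphic_def
    by (rule exI [of _ e]) (auto simp: contra_comp_def id_functor_def e K_nat P K Gobj)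
  \<comment> \<open>\<open>e' (?F X)\<close> runs from \<open>?F X\<close> to
    \<open>?F (G (?F X))\<close>, so its lift runs from \<open>G (?F X)\<close> to \<open>X\<close>.
    The lift \<open>u'\<close> of \<open>e (?F X)\<close> is its inverse because \<open>F\<close>
    reflects equations.\<close>
  define u where "u X = P (G (?F X)) X (e' (?F X))" for X
  define u' where "u' X = P X (G (?F X)) (e (?F X))" for X
  have u: "u X \<in> hom C (G (?F X)) X" "?FH (G (?F X)) X (u X) = e' (?F X)"
    and u': "u' X \<in> hom C X (G (?F X))" "?FH X (G (?F X)) (u' X) = e (?F X)" if "X \<in> obj C" for X
    using that unfolding u_def u'_def by (simp_all add: P Gobj F.on_obj_in e' e_hom)
  have u_iso: "iso_in C (G (?F X)) X (u X)" if "X \<in> obj C" for X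
    unfolding iso_in_def
  proof (intro conjI bexI)
    show "u X \<in> hom C (G (?F X)) X" "u' X \<in> hom C X (G (?F X))"
      using that by (simp_all add: u u')
    show "cmp C (G (?F X)) X (G (?F X)) (u' X) (u X) = ident C (G (?F X))"
      by (rule eqI [of "G (?F X)" "G (?F X)"]) (use that in \<open>auto simp: F.on_hom_comp F.on_hom_ident u u' Gobj F.on_obj_in e'
        C.ident_in_hom intro: C.comp_in_hom [of _ X]\<close>)
    show "cmp C X (G (?F X)) X (u X) (u' X) = ident C X"
      by (rule eqI [of X X]) (use that in \<open>auto simp: F.on_hom_comp F.on_hom_ident u u' Gobj F.on_obj_in e'
        C.ident_in_hom intro: C.comp_in_hom [of _ "G (?F X)"]\<close>)
  qed
  \<comment> \<open>Applying \<open>F\<close> turns this square into \<open>K_nat'\<close> for the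
    morphism \<open>?FH X Y f\<close>.\<close>
  have u_nat: "cmp C (G (?F X)) (G (?F Y)) Y (u Y) (P (G (?F X)) (G (?F Y)) (K (?F Y) (?F X) (?FH X Y f)))
     = cmp C (G (?F X)) X Y f (u X)"
    if "X \<in> obj C" "Y \<in> obj C" "f \<in> hom C X Y" for X Y f
  proof -
    note facts = that F.on_obj_in Gobj F.on_hom_in K P u
    show ?thesis
    proof (rule eqI)
      show "cmp C (G (?F X)) X Y f (u X) \<in> hom C (G (?F X)) Y"
        by (rule C.comp_in_hom) (use facts in auto)
      show "cmp C (G (?F X)) (G (?F Y)) Y (u Y) (P (G (?F X)) (G (?F Y)) (K (?F Y) (?F X) (?FH X Y f)))
         \<in> hom C (G (?F X)) Y"
        by (rule C.comp_in_hom) (use facts in auto)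
    qed (use facts in \<open>auto simp: F.on_hom_comp K_nat'\<close>)
  qed
  have unit: "naturally_isomorphic C C (contra_comp GF F) id_functor"
    unfolding naturally_isomorphic_def
    by (rule exI [of _ u]) (auto simp: contra_comp_def id_functor_def u_iso u_nat)
  show ?thesis
    unfolding dually_equivalent_def using C D F GF unit counit by blast
qed

section \<open>Zero-dimensional Hausdorff spaces and homeomorphic copies\<close>

text \<open>A base of clopen sets may be enlarged to the set of all clopen sets, so the existential
  over bases becomes a condition on clopen neighbourhoods.\<close>

lemma zero_dimensional_Hausdorff_iff:
  "zero_dimensional_Hausdorff X \<longleftrightarrow> Hausdorff_space X \<and>
    (\<forall>W x. openin X W \<and> x \<in> W \<longrightarrow> (\<exists>V\<in>CO X. x \<in> V \<and> V \<subseteq> W))"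
  unfolding zero_dimensional_Hausdorff_def openin_topology_base_unique
proof (intro conj_cong refl iffI)
  assume "\<forall>W x. openin X W \<and> x \<in> W \<longrightarrow> (\<exists>V\<in>CO X. x \<in> V \<and> V \<subseteq> W)"
  then show "\<exists>B\<subseteq>CO X. (\<forall>V. V \<in> B \<longrightarrow> openin X V) \<and>
      (\<forall>W x. openin X W \<and> x \<in> W \<longrightarrow> (\<exists>V. V \<in> B \<and> x \<in> V \<and> V \<subseteq> W))"
    by (intro exI [of _ "CO X"]) (auto simp: CO_def)
qed blast

lemma clopen_neighbourhood:
  "\<lbrakk>zero_dimensional_Hausdorff X; openin X W; x \<in> W\<rbrakk> \<Longrightarrow> \<exists>V\<in>CO X. x \<in> V \<and> V \<subseteq> W"
  by (simp add: zero_dimensional_Hausdorff_iff)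

lemma CO_closed:
  "V \<in> CO Z \<Longrightarrow> W \<in> CO Z \<Longrightarrow> V \<inter> W \<in> CO Z"
  "V \<in> CO Z \<Longrightarrow> W \<in> CO Z \<Longrightarrow> V \<union> W \<in> CO Z"
  "V \<in> CO Z \<Longrightarrow> topspace Z - V \<in> CO Z"
  "{} \<in> CO Z" "topspace Z \<in> CO Z"
  by (auto simp: CO_def)

lemma CO_subset: "V \<in> CO Z \<Longrightarrow> V \<subseteq> topspace Z"
  by (auto simp: CO_def dest: openin_subset)

lemma CO_preimage:
  "continuous_map X Y f \<Longrightarrow> V \<in> CO Y \<Longrightarrow> {x \<in> topspace X. f x \<in> V} \<in> CO X"
  by (simp add: CO_def openin_continuous_map_preimage closedin_continuous_map_preimage)

lemma homeomorphic_maps_zero_dimensional_Hausdorff: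
  assumes "homeomorphic_maps X Y f g" and X: "zero_dimensional_Hausdorff X"
  shows "zero_dimensional_Hausdorff Y"
  unfolding zero_dimensional_Hausdorff_iff
proof (intro conjI allI impI)
  have f: "continuous_map X Y f" and g: "continuous_map Y X g"
    and fg: "\<And>y. y \<in> topspace Y \<Longrightarrow> f (g y) = y"
    using assms(1) by (auto simp: homeomorphic_maps_def)
  show "Hausdorff_space Y"
    using X homeomorphic_Hausdorff_space [OF homeomorphic_maps_imp_homeomorphic_space [OF assms(1)]]
    by (simp add: zero_dimensional_Hausdorff_def)
  fix W y assume W: "openin Y W \<and> y \<in> W"
  then have y: "y \<in> topspace Y"
    using openin_subset by blast
  \<comment> \<open>The open set is moved to \<open>X\<close> by \<open>f\<close>, shrunk there to a
    clopen set around \<open>g y\<close>, and moved back along \<open>g\<close>.\<close>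
  have "openin X {x \<in> topspace X. f x \<in> W}"
    using openin_continuous_map_preimage [OF f] W by simp
  moreover have "g y \<in> {x \<in> topspace X. f x \<in> W}"
    using W fg [OF y] funcset_mem [OF continuous_map_funspace [OF g] y] by simp
  ultimately obtain V where V: "V \<in> CO X" "g y \<in> V" "V \<subseteq> {x \<in> topspace X. f x \<in> W}"
    using clopen_neighbourhood [OF X] by meson
  have "{y \<in> topspace Y. g y \<in> V} \<in> CO Y"
    using g V(1) by (rule CO_preimage)
  moreover have "{y \<in> topspace Y. g y \<in> V} \<subseteq> W"
  proof
    fix z assume "z \<in> {y \<in> topspace Y. g y \<in> V}"
    then have "f (g z) = z" "g z \<in> {x \<in> topspace X. f x \<in> W}"
      using V(3) fg by auto
    then show "z \<in> W" by simp
  qed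
  ultimately show "\<exists>V\<in>CO Y. y \<in> V \<and> V \<subseteq> W"
    using y V(2) by (intro bexI [of _ "{y \<in> topspace Y. g y \<in> V}"]) auto
qed

text \<open>If the points differed, some open set would contain \<open>x\<close> but not
  \<open>y\<close>, and a clopen neighbourhood of \<open>x\<close> inside it would tell them
  apart.\<close>

lemma CO_ext:
  assumes "zero_dimensional_Hausdorff X" "x \<in> topspace X" "y \<in> topspace X"
    and "\<And>V. V \<in> CO X \<Longrightarrow> x \<in> V \<longleftrightarrow> y \<in> V"
  shows "x = y"
proof (rule ccontr)
  assume "x \<noteq> y"
  then obtain W where "openin X W" "x \<in> W" "y \<notin> W"
    using assms(1-3) unfolding zero_dimensional_Hausdorff_def Hausdorff_space_def disjnt_def
    by blast
  then obtain V where "V \<in> CO X" "x \<in> V" "V \<subseteq> W"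
    using clopen_neighbourhood [OF assms(1)] by meson
  then show False
    using assms(4) \<open>y \<notin> W\<close> by blast
qed

section \<open>Copies along injections and conjugation by homeomorphisms\<close>

lemma homeomorphic_maps_pullback_topology:
  assumes "inj_on e (topspace T)"
  shows "homeomorphic_maps T
    (pullback_topology (e ` topspace T) (inv_into (topspace T) e) T) e (inv_into (topspace T) e)"
proof -
  let ?d = "inv_into (topspace T) e"
  \<comment> \<open>A map into the carrier of a pullback topology is continuous as soon as its
    composite with the pulled-back map is; here this composite agrees with the identity on
    \<open>topspace T\<close>.\<close>
  have "continuous_map T T (?d \<circ> e)"
    by (rule continuous_map_eq [OF continuous_map_id]) (simp add: assms)
  then have "continuous_map T (pullback_topology (e ` topspace T) ?d T) e"
    by (rule continuous_map_pullback') auto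
  moreover have "continuous_map (pullback_topology (e ` topspace T) ?d T) T (id \<circ> ?d)"
    by (rule continuous_map_pullback) simp
  ultimately show ?thesis
    using assms by (auto simp: homeomorphic_maps_def topspace_pullback_topology)
qed

lemma continuous_map_restrict_iff [simp]:
  "continuous_map X Y (restrict f (topspace X)) \<longleftrightarrow> continuous_map X Y f"
  by (metis continuous_map_eq restrict_apply')

lemma iso_in_ZHaus:
  assumes "homeomorphic_maps X Y f g"
  shows "iso_in (ZHaus U) X Y (restrict f (topspace X))"
  unfolding iso_in_def
proof (intro conjI bexI [where x = "restrict g (topspace Y)"])
  have f: "continuous_map X Y f" "continuous_map Y X g"
    "\<And>x. x \<in> topspace X \<Longrightarrow> g (f x) = x" "\<And>y. y \<in> topspace Y \<Longrightarrow> f (g y) = y"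
    "\<And>x. x \<in> topspace X \<Longrightarrow> f x \<in> topspace Y" "\<And>y. y \<in> topspace Y \<Longrightarrow> g y \<in> topspace X"
    using assms by (auto simp: homeomorphic_maps_def continuous_map_def)
  then show "restrict f (topspace X) \<in> hom (ZHaus U) X Y"
    "restrict g (topspace Y) \<in> hom (ZHaus U) Y X"
    by (auto simp: ZHaus_def)
  show "cmp (ZHaus U) X Y X (restrict g (topspace Y)) (restrict f (topspace X)) = ident (ZHaus U) X"
    "cmp (ZHaus U) Y X Y (restrict f (topspace X)) (restrict g (topspace Y)) = ident (ZHaus U) Y"
    using f by (auto simp: ZHaus_def compose_def fun_eq_iff)
qed

lemma small_lepoll: "\<lbrakk>small U S; R \<lesssim> S\<rbrakk> \<Longrightarrow> small U R"
  unfolding small_def using lepoll_trans by blast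

lemma lepoll_Pow_mono: "S \<lesssim> T \<Longrightarrow> Pow S \<lesssim> Pow T"
  unfolding lepoll_def by (metis image_Pow_mono inj_on_image_Pow)

text \<open>Conjugation by homeomorphisms is undone by conjugation with their inverses. The
  restrictions do no harm, since the functions compared are extensional.\<close>

lemma bij_betw_continuous_maps:
  assumes "homeomorphic_maps T T' e d" "homeomorphic_maps S S' e' d'"
  shows "bij_betw (\<lambda>f. restrict (e' \<circ> f \<circ> d) (topspace T'))
    {f \<in> extensional (topspace T). continuous_map T S f}
    {f \<in> extensional (topspace T'). continuous_map T' S' f}"
proof -
  have T: "continuous_map T T' e" "continuous_map T' T d"
    "\<And>x. x \<in> topspace T \<Longrightarrow> d (e x) = x" "\<And>x. x \<in> topspace T' \<Longrightarrow> e (d x) = x"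
    "\<And>x. x \<in> topspace T \<Longrightarrow> e x \<in> topspace T'" "\<And>x. x \<in> topspace T' \<Longrightarrow> d x \<in> topspace T"
    and S: "continuous_map S S' e'" "continuous_map S' S d'"
    "\<And>x. x \<in> topspace S \<Longrightarrow> d' (e' x) = x" "\<And>x. x \<in> topspace S' \<Longrightarrow> e' (d' x) = x"
    using assms by (auto simp: homeomorphic_maps_def continuous_map_def)
  show ?thesis
  proof (rule bij_betw_byWitness [where f' = "\<lambda>f. restrict (d' \<circ> f \<circ> e) (topspace T)"])
    show "(\<lambda>f. restrict (e' \<circ> f \<circ> d) (topspace T')) ` {f \<in> extensional (topspace T). continuous_map T S f}
      \<subseteq> {f \<in> extensional (topspace T'). continuous_map T' S' f}"
      using T(2) S(1) by (auto intro!: continuous_map_compose)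
    show "(\<lambda>f. restrict (d' \<circ> f \<circ> e) (topspace T)) ` {f \<in> extensional (topspace T'). continuous_map T' S' f}
      \<subseteq> {f \<in> extensional (topspace T). continuous_map T S f}"
      using T(1) S(2) by (auto intro!: continuous_map_compose)
    show "\<forall>f\<in>{f \<in> extensional (topspace T). continuous_map T S f}.
      restrict (d' \<circ> restrict (e' \<circ> f \<circ> d) (topspace T') \<circ> e) (topspace T) = f"
    proof
      fix f assume "f \<in> {f \<in> extensional (topspace T). continuous_map T S f}"
      then have f: "f \<in> extensional (topspace T)" "f \<in> topspace T \<rightarrow> topspace S"
        by (simp_all add: continuous_map_funspace)
      show "restrict (d' \<circ> restrict (e' \<circ> f \<circ> d) (topspace T') \<circ> e) (topspace T) = f"
        by (rule extensionalityI [OF _ f(1)]) (simp_all add: T S funcset_mem [OF f(2)])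
    qed
    show "\<forall>f\<in>{f \<in> extensional (topspace T'). continuous_map T' S' f}.
      restrict (e' \<circ> restrict (d' \<circ> f \<circ> e) (topspace T) \<circ> d) (topspace T') = f"
    proof
      fix f assume "f \<in> {f \<in> extensional (topspace T'). continuous_map T' S' f}"
      then have f: "f \<in> extensional (topspace T')" "f \<in> topspace T' \<rightarrow> topspace S'"
        by (simp_all add: continuous_map_funspace)
      show "restrict (e' \<circ> restrict (d' \<circ> f \<circ> e) (topspace T) \<circ> d) (topspace T') = f"
        by (rule extensionalityI [OF _ f(1)]) (simp_all add: T S funcset_mem [OF f(2)])
    qed
  qed
qed

section \<open>Subspaces of Stone spaces\<close>

text \<open>A vanishing difference \<open>conj A x (compl A y)\<close> forces
  \<open>x = conj A x y\<close>; by commutativity both elements equal their meet.\<close>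

lemma (in bool_alg) eq_if_differences_zero:
  assumes "a \<in> carr A" "b \<in> carr A"
    and "conj A a (compl A b) = zero A" "conj A b (compl A a) = zero A"
  shows "a = b"
proof -
  have "x = conj A x y" if "x \<in> carr A" "y \<in> carr A" "conj A x (compl A y) = zero A" for x y
  proof -
    have "x = conj A x (disj A y (compl A y))"
      using that by (simp add: disj_cancel_right conj_one_right)
    also have "\<dots> = conj A x y"
      using that by (simp add: conj_disj_distrib compl_closed conj_closed disj_zero_right)
    finally show ?thesis .
  qed
  from this [of a b] this [of b a] show ?thesis
    using assms by (simp add: conj_commute)
qed

lemma Boole_two_simps:
  assumes "x \<in> Boole A two"
  shows "\<lbrakk>a \<in> carr A; b \<in> carr A\<rbrakk> \<Longrightarrow> x (conj A a b) \<longleftrightarrow> x a \<and> x b"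
    and "\<lbrakk>a \<in> carr A; b \<in> carr A\<rbrakk> \<Longrightarrow> x (disj A a b) \<longleftrightarrow> x a \<or> x b"
    and "a \<in> carr A \<Longrightarrow> x (compl A a) \<longleftrightarrow> \<not> x a"
    and "x (zero A) \<longleftrightarrow> False" "x (one A) \<longleftrightarrow> True"
  using assms by (auto simp: Boole_def two_def)

lemma z_algebraD:
  assumes "z_algebra (A, X)"
  shows "bool_alg A" "X \<subseteq> Boole A two"
    and "\<lbrakk>a \<in> carr A; a \<noteq> zero A\<rbrakk> \<Longrightarrow> \<exists>x\<in>X. x a"
  using assms by (auto simp: z_algebra_def two_def)

text \<open>If a difference of the two elements were nonzero, the z-algebra condition would yield a
  point of \<open>X\<close> true at one and false at the other. So \<open>X\<close> separates the
  elements of \<open>A\<close>, which reduces equations in \<open>A\<close> to equations of truth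
  values.\<close>

lemma z_algebra_eqI:
  assumes "z_algebra (A, X)" and ab: "a \<in> carr A" "b \<in> carr A"
    and eq: "\<And>x. x \<in> X \<Longrightarrow> x a = x b"
  shows "a = b"
proof -
  interpret bool_alg A
    using assms(1) by (simp add: z_algebra_def)
  have "conj A c (compl A d) = zero A"
    if cd: "c \<in> carr A" "d \<in> carr A" and eq: "\<And>x. x \<in> X \<Longrightarrow> x c = x d" for c d
  proof (rule ccontr)
    assume "conj A c (compl A d) \<noteq> zero A"
    moreover have "conj A c (compl A d) \<in> carr A"
      using cd by (simp add: conj_closed compl_closed)
    ultimately obtain x where x: "x \<in> X" "x \<in> Boole A two" "x (conj A c (compl A d))"
      using z_algebraD(2,3) [OF assms(1)] by (metis subsetD)
    then have "x c" "\<not> x d"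
      using cd by (simp_all add: Boole_two_simps [OF x(2)] compl_closed)
    then show False
      using eq [OF x(1)] by simp
  qed
  from eq_if_differences_zero [OF ab this [OF ab eq] this [OF ab(2,1) eq [symmetric]]]
  show ?thesis .
qed

section \<open>The topology on a set of two-valued homomorphisms\<close>

lemma topspace_subtopology_stone_space:
  "bool_alg A \<Longrightarrow> X \<subseteq> Boole A two \<Longrightarrow> topspace (subtopology (stone_space A) X) = X"
  by (auto simp: topspace_stone_space)

lemma openin_subtopology_stone_space:
  assumes "bool_alg A"
  shows "openin (subtopology (stone_space A) X) =
    arbitrary union_of (\<lambda>V. V \<in> (\<lambda>a. X \<inter> stone_set A a) ` carr A)"
proof -
  have "(\<lambda>V. V \<in> stone_set A ` carr A) relative_to X =
      (\<lambda>V. V \<in> (\<lambda>a. X \<inter> stone_set A a) ` carr A)"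
    by (auto simp: relative_to_def fun_eq_iff)
  then show ?thesis
    by (simp add: openin_stone_space [OF assms] arbitrary_union_of_relative_to
        flip: openin_relative_to)
qed

lemma stone_set_compl:
  "a \<in> carr A \<Longrightarrow> stone_set A (compl A a) = Boole A two - stone_set A a"
  by (auto simp: stone_set_def Boole_def two_def)

text \<open>The complement within \<open>X\<close> is the trace of
  \<open>stone_set A (compl A a)\<close>, hence open as well.\<close>

lemma stone_set_in_CO:
  assumes "bool_alg A" "X \<subseteq> Boole A two" "a \<in> carr A"
  shows "X \<inter> stone_set A a \<in> CO (subtopology (stone_space A) X)"
proof -
  have "openin (subtopology (stone_space A) X) (X \<inter> stone_set A b)" if "b \<in> carr A" for b
    unfolding openin_subtopology_stone_space [OF assms(1)]
    using that by (intro arbitrary_union_of_inc) simp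
  moreover have "X - X \<inter> stone_set A a = X \<inter> stone_set A (compl A a)"
    using assms by (auto simp: stone_set_compl)
  ultimately show ?thesis
    using assms by (simp add: CO_def closedin_def topspace_subtopology_stone_space
        bool_alg.compl_closed del: topspace_subtopology)
qed

text \<open>The traces of the Stone sets form a clopen base. Distinct homomorphisms disagree at some
  \<open>a\<close>, so the trace belonging to \<open>a\<close> and its complement separate
  them.\<close>

lemma zero_dimensional_Hausdorff_subtopology_stone_space:
  assumes A: "bool_alg A" and X: "X \<subseteq> Boole A two"
  shows "zero_dimensional_Hausdorff (subtopology (stone_space A) X)"
  unfolding zero_dimensional_Hausdorff_def
proof (intro conjI exI)
  let ?T = "subtopology (stone_space A) X"
  show "(\<lambda>a. X \<inter> stone_set A a) ` carr A \<subseteq> CO ?T"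
    using stone_set_in_CO [OF A X] by (simp add: image_subset_iff)
  show "openin ?T = arbitrary union_of (\<lambda>V. V \<in> (\<lambda>a. X \<inter> stone_set A a) ` carr A)"
    by (rule openin_subtopology_stone_space [OF A])
  show "Hausdorff_space ?T"
    unfolding Hausdorff_space_def topspace_subtopology_stone_space [OF A X]
  proof (intro allI impI)
    fix x y assume xy: "x \<in> X \<and> y \<in> X \<and> x \<noteq> y"
    have "x \<in> carr A \<rightarrow>\<^sub>E carr two" "y \<in> carr A \<rightarrow>\<^sub>E carr two"
      using xy X by (auto simp: Boole_def)
    from PiE_ext [OF this] xy obtain a where a: "a \<in> carr A" "x a \<noteq> y a"
      by metis
    let ?V = "X \<inter> stone_set A a"
    have V: "openin ?T ?V" "openin ?T (X - ?V)"
      using stone_set_in_CO [OF A X a(1)] topspace_subtopology_stone_space [OF A X]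
      unfolding CO_def closedin_def by simp_all
    have disj: "disjnt ?V (X - ?V)" "disjnt (X - ?V) ?V"
      by (auto simp: disjnt_def)
    have "x \<in> Boole A two" "y \<in> Boole A two"
      using xy X by auto
    then consider "x \<in> ?V" "y \<in> X - ?V" | "x \<in> X - ?V" "y \<in> ?V"
      using xy a(2) by (auto simp: stone_set_def two_def)
    then show "\<exists>V W. openin ?T V \<and> openin ?T W \<and> x \<in> V \<and> y \<in> W \<and> disjnt V W"
      by cases (use V disj in metis)+
  qed
qed

text \<open>Continuity can be tested on the base, and for \<open>f\<close> with values in
  \<open>X\<close> the preimage of the basic set of \<open>a\<close> is the set of \<open>t\<close>
  with \<open>f t a\<close>.\<close>

lemma continuous_map_into_stone_space_iff:
  assumes A: "bool_alg A" and X: "X \<subseteq> Boole A two"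
  shows "continuous_map T (subtopology (stone_space A) X) f \<longleftrightarrow>
    f \<in> topspace T \<rightarrow> X \<and> (\<forall>a\<in>carr A. openin T {t \<in> topspace T. f t a})"
proof -
  have eq: "{t \<in> topspace T. f t \<in> X \<inter> stone_set A a} = {t \<in> topspace T. f t a}"
    if "f \<in> topspace T \<rightarrow> X" for a
    using that X by (auto simp: stone_set_def two_def)
  show ?thesis
    unfolding continuous_map_into_topology_base_eq [OF openin_subtopology_stone_space [OF A]]
      topspace_subtopology_stone_space [OF A X]
    by (intro conj_cong refl) (simp add: eq del: Int_iff flip: Ball_def)
qed

section \<open>Homomorphisms dual to maps of points\<close>

lemma Boole_if_dual:
  assumes A: "bool_alg A" and X: "X \<subseteq> Boole A two" and BY: "z_algebra (B, Y)"
    and f: "f \<in> Y \<rightarrow> X" and \<phi>: "\<phi> \<in> carr A \<rightarrow>\<^sub>E carr B"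
    and dual: "\<And>a y. a \<in> carr A \<Longrightarrow> y \<in> Y \<Longrightarrow> y (\<phi> a) = f y a"
  shows "\<phi> \<in> Boole A B"
proof -
  interpret A: bool_alg A by fact
  interpret B: bool_alg B
    using BY by (simp add: z_algebra_def)
  have Y: "Y \<subseteq> Boole B two" and fX: "\<And>y. y \<in> Y \<Longrightarrow> f y \<in> Boole A two"
    using BY f X by (auto simp: z_algebra_def)
  have \<phi>': "\<And>a. a \<in> carr A \<Longrightarrow> \<phi> a \<in> carr B"
    using \<phi> by auto
  note closed = A.conj_closed A.disj_closed A.compl_closed A.zero_closed A.one_closed
    B.conj_closed B.disj_closed B.compl_closed B.zero_closed B.one_closed \<phi>'
  \<comment> \<open>As \<open>Y\<close> separates the elements of \<open>B\<close>, each
    homomorphism law for \<phi> may be tested at every \<open>y\<close> in \<open>Y\<close>, where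
    it becomes the same law for the homomorphism \<open>f y\<close>.\<close>
  show ?thesis
    unfolding Boole_def [of A B]
    using \<phi> Y fX
    by (auto intro!: z_algebra_eqI [OF BY]
        simp: closed dual Boole_two_simps [of _ A] Boole_two_simps [of _ B] subset_iff)
qed

lemma dual_unique:
  assumes BY: "z_algebra (B, Y)" and "\<phi> \<in> carr A \<rightarrow>\<^sub>E carr B" "\<psi> \<in> carr A \<rightarrow>\<^sub>E carr B"
    and "\<And>a y. a \<in> carr A \<Longrightarrow> y \<in> Y \<Longrightarrow> y (\<phi> a) = y (\<psi> a)"
  shows "\<phi> = \<psi>"
  using assms(2-) by (intro PiE_ext z_algebra_eqI [OF BY]) auto

text \<open>Here the dz condition enters: the preimage under \<open>f\<close> of the trace belonging
  to \<open>a\<close> is clopen in \<open>Y\<close>, hence the trace belonging to some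
  \<open>b\<close> in \<open>B\<close>, and this \<open>b\<close> serves as the value at
  \<open>a\<close>.\<close>

lemma dual_exists:
  assumes A: "bool_alg A" and X: "X \<subseteq> Boole A two" and BY: "dz_algebra (B, Y)"
    and f: "continuous_map (subtopology (stone_space B) Y) (subtopology (stone_space A) X) f"
  obtains \<phi> where "\<phi> \<in> Boole A B" "\<And>a y. a \<in> carr A \<Longrightarrow> y \<in> Y \<Longrightarrow> y (\<phi> a) = f y a"
proof -
  have z: "z_algebra (B, Y)" and CO: "(\<lambda>a. Y \<inter> stone_set B a) ` carr B = CO (subtopology (stone_space B) Y)"
    using BY by (auto simp: dz_algebra_def)
  then have B: "bool_alg B" and Y: "Y \<subseteq> Boole B two"
    by (auto simp: z_algebra_def)
  note top = topspace_subtopology_stone_space [OF A X] topspace_subtopology_stone_space [OF B Y]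
  have fYX: "f \<in> Y \<rightarrow> X"
    using continuous_map_funspace [OF f] by (simp add: top del: topspace_subtopology)
  have "\<exists>b. b \<in> carr B \<and> (\<forall>y\<in>Y. y b = f y a)" if "a \<in> carr A" for a
  proof -
    have "{y \<in> Y. f y \<in> X \<inter> stone_set A a} \<in> (\<lambda>a. Y \<inter> stone_set B a) ` carr B"
      using CO_preimage [OF f stone_set_in_CO [OF A X that]] CO
      by (simp add: top del: topspace_subtopology)
    then obtain b where b: "b \<in> carr B" "{y \<in> Y. f y \<in> X \<inter> stone_set A a} = Y \<inter> stone_set B b"
      by blast
    have "y b = f y a" if "y \<in> Y" for y
    proof -
      have "y \<in> Boole B two" "f y \<in> X" "f y \<in> Boole A two"
        using that fYX X Y by auto
      then show ?thesis
        using that b(2) by (auto simp: stone_set_def two_def set_eq_iff)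
    qed
    then show ?thesis using b(1) by blast
  qed
  then obtain \<phi> where \<phi>: "\<And>a. a \<in> carr A \<Longrightarrow> \<phi> a \<in> carr B \<and> (\<forall>y\<in>Y. y (\<phi> a) = f y a)"
    by metis
  show ?thesis
  proof
    show "restrict \<phi> (carr A) \<in> Boole A B"
      by (rule Boole_if_dual [OF A X z fYX]) (use \<phi> in auto)
  qed (use \<phi> in auto)
qed

section \<open>The algebra of clopen sets\<close>

text \<open>
  The clopen sets are coded as elements of \<open>'a\<close> by a map \<open>i\<close> that is injective on \<open>CO Z\<close>; the
  point \<open>z\<close> becomes the homomorphism that tests membership of \<open>z\<close>.
\<close>

definition clopen_algebra :: "('p set \<Rightarrow> 'a) \<Rightarrow> 'p topology \<Rightarrow> 'a balg" where
  "clopen_algebra i Z = (let c = inv_into (CO Z) i in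
    \<lparr>carr = i ` CO Z, conj = (\<lambda>a b. i (c a \<inter> c b)), disj = (\<lambda>a b. i (c a \<union> c b)),
     compl = (\<lambda>a. i (topspace Z - c a)), zero = i {}, one = i (topspace Z)\<rparr>)"

definition clopen_point :: "('p set \<Rightarrow> 'a) \<Rightarrow> 'p topology \<Rightarrow> 'p \<Rightarrow> 'a \<Rightarrow> bool" where
  "clopen_point i Z z = (\<lambda>a\<in>i ` CO Z. z \<in> inv_into (CO Z) i a)"

context
  fixes Z :: "'p topology" and i :: "'p set \<Rightarrow> 'a"
  assumes Z: "zero_dimensional_Hausdorff Z" and i: "inj_on i (CO Z)"
begin

lemma bool_alg_clopen_algebra: "bool_alg (clopen_algebra i Z)"
proof -
  \<comment> \<open>Both laws rest on clopen sets lying inside the space. Once injectivity of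
    \<open>i\<close> has removed the decoding, what remains of the axioms is plain set
    algebra.\<close>
  have laws: "V \<inter> topspace Z = V" "V \<union> topspace Z = topspace Z" if "V \<in> CO Z" for V
    using CO_subset [OF that] by blast+
  show ?thesis
    by unfold_locales
      (clarsimp simp: clopen_algebra_def Let_def i CO_closed laws;
        (rule arg_cong [where f = i], blast)?)+
qed

lemma clopen_point_apply: "V \<in> CO Z \<Longrightarrow> clopen_point i Z z (i V) \<longleftrightarrow> z \<in> V"
  by (simp add: clopen_point_def i)

lemma clopen_point_in_Boole:
  assumes "z \<in> topspace Z"
  shows "clopen_point i Z z \<in> Boole (clopen_algebra i Z) two"
proof -
  have "clopen_point i Z z \<in> i ` CO Z \<rightarrow>\<^sub>E UNIV"
    by (simp add: clopen_point_def)
  then show ?thesis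
    using assms
    by (simp add: Boole_def clopen_algebra_def two_def Let_def i CO_closed clopen_point_apply)
qed

lemma inj_on_clopen_point: "inj_on (clopen_point i Z) (topspace Z)"
proof (rule inj_onI)
  fix x y assume xy: "x \<in> topspace Z" "y \<in> topspace Z" and eq: "clopen_point i Z x = clopen_point i Z y"
  show "x = y"
  proof (rule CO_ext [OF Z xy])
    fix V assume V: "V \<in> CO Z"
    show "x \<in> V \<longleftrightarrow> y \<in> V"
      unfolding clopen_point_apply [OF V, symmetric] eq ..
  qed
qed

text \<open>Membership of \<open>z\<close> in \<open>V\<close> is the truth of its homomorphism at
  the code \<open>i V\<close>. This exchanges clopen sets of \<open>Z\<close> with traces of Stone
  sets, and serves both the openness of the embedding and the dz condition.\<close>

lemma clopen_point_image:
  assumes "V \<in> CO Z"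
  shows "clopen_point i Z ` V = clopen_point i Z ` topspace Z \<inter> stone_set (clopen_algebra i Z) (i V)"
proof -
  have "clopen_point i Z z \<in> stone_set (clopen_algebra i Z) (i V) \<longleftrightarrow> z \<in> V" if "z \<in> topspace Z" for z
    using clopen_point_in_Boole [OF that]
    by (simp add: stone_set_def two_def clopen_point_apply [OF assms])
  then show ?thesis
    using CO_subset [OF assms] by blast
qed

text \<open>Preimages of basic open sets are clopen sets of \<open>Z\<close>, which gives
  continuity. Images of clopen sets are basic open sets, and by zero-dimensionality every open set
  is a union of clopen ones, which gives openness.\<close>

lemma homeomorphic_map_clopen_point:
  "homeomorphic_map Z
    (subtopology (stone_space (clopen_algebra i Z)) (clopen_point i Z ` topspace Z)) (clopen_point i Z)"
  (is "homeomorphic_map Z ?T ?p")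
proof (rule bijective_open_imp_homeomorphic_map)
  let ?A = "clopen_algebra i Z"
  have A: "bool_alg ?A" and X: "?p ` topspace Z \<subseteq> Boole ?A two"
    using bool_alg_clopen_algebra clopen_point_in_Boole by auto
  have carr: "carr ?A = i ` CO Z"
    by (simp add: clopen_algebra_def Let_def)
  have "{z \<in> topspace Z. ?p z (i V)} = V" if "V \<in> CO Z" for V
    using CO_subset [OF that] by (auto simp: clopen_point_apply [OF that])
  then show "continuous_map Z ?T ?p"
    unfolding continuous_map_into_stone_space_iff [OF A X]
    by (auto simp: carr CO_def)
  show "?p ` topspace Z = topspace ?T"
    by (rule topspace_subtopology_stone_space [OF A X, symmetric])
  show "inj_on ?p (topspace Z)"
    by (rule inj_on_clopen_point)
  show "open_map Z ?T ?p"
    unfolding open_map_def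
  proof (intro allI impI)
    fix W assume "openin Z W"
    then have "W = \<Union>{V \<in> CO Z. V \<subseteq> W}"
      using Z unfolding zero_dimensional_Hausdorff_iff by blast
    then have "?p ` W = \<Union>((`) ?p ` {V \<in> CO Z. V \<subseteq> W})"
      by (metis image_Union)
    moreover have "openin ?T (?p ` V)" if "V \<in> CO Z" for V
      using stone_set_in_CO [OF A X, of "i V"] that unfolding clopen_point_image [OF that] carr
      by (simp add: CO_def)
    ultimately show "openin ?T (?p ` W)"
      by auto
  qed
qed

lemma dz_algebra_clopen_algebra:
  "dz_algebra (clopen_algebra i Z, clopen_point i Z ` topspace Z)"
proof -
  let ?A = "clopen_algebra i Z" and ?p = "clopen_point i Z"
  let ?T = "subtopology (stone_space ?A) (?p ` topspace Z)"
  have A: "bool_alg ?A" and X: "?p ` topspace Z \<subseteq> Boole ?A two"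
    using bool_alg_clopen_algebra clopen_point_in_Boole by auto
  have carr: "carr ?A = i ` CO Z"
    by (simp add: clopen_algebra_def Let_def)
  \<comment> \<open>A clopen set with nonzero code is nonempty, and any of its points is a
    witness.\<close>
  have "\<exists>z\<in>topspace Z. ?p z (i V)" if "V \<in> CO Z" "i V \<noteq> zero ?A" for V
  proof -
    from that have "V \<noteq> {}"
      by (auto simp: clopen_algebra_def Let_def)
    then show ?thesis
      using CO_subset [OF that(1)] by (auto simp: clopen_point_apply [OF that(1)])
  qed
  then have "z_algebra (?A, ?p ` topspace Z)"
    using A X by (auto simp: z_algebra_def carr two_def)
  \<comment> \<open>A clopen set of the image pulls back along \<open>?p\<close> to a clopen set of
    \<open>Z\<close>, whose code is the required element of the algebra.\<close>
  moreover have "V \<in> (\<lambda>a. ?p ` topspace Z \<inter> stone_set ?A a) ` carr ?A" if V: "V \<in> CO ?T" for V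
  proof -
    let ?V = "{z \<in> topspace Z. ?p z \<in> V}"
    have V': "?V \<in> CO Z"
      using V homeomorphic_imp_continuous_map [OF homeomorphic_map_clopen_point]
      by (intro CO_preimage)
    moreover have "?p ` ?V = V"
      using CO_subset [OF V] by auto
    ultimately show ?thesis
      using clopen_point_image [OF V'] V' unfolding carr by (metis (no_types, lifting) image_eqI)
  qed
  ultimately show ?thesis
    using stone_set_in_CO [OF A X] unfolding dz_algebra_def by auto
qed

end

section \<open>The space of points of a dz-algebra\<close>

definition stone_subspace :: "'a zalg \<Rightarrow> ('a \<Rightarrow> bool) topology" where
  "stone_subspace M = subtopology (stone_space (fst M)) (snd M)"

text \<open>
  The points of a dz-algebra over \<open>'a\<close> have type \<open>'a \<Rightarrow> bool\<close>, whereas spaces have points in \<open>'p\<close>;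
  hence the space is copied along \<open>code\<close>, which is injective on \<open>snd M\<close> only when such an injection
  exists.
\<close>

definition code :: "'a zalg \<Rightarrow> ('a \<Rightarrow> bool) \<Rightarrow> 'p" where
  "code M = (SOME e. inj_on e (snd M))"

definition decode :: "'a zalg \<Rightarrow> 'p \<Rightarrow> ('a \<Rightarrow> bool)" where
  "decode M = inv_into (snd M) (code M)"

definition point_space :: "'a zalg \<Rightarrow> 'p topology" where
  "point_space M = pullback_topology (code M ` snd M) (decode M) (stone_subspace M)"

definition point_functor ::
  "('a zalg, ('a \<Rightarrow> 'a) \<times> (('a \<Rightarrow> bool) \<Rightarrow> ('a \<Rightarrow> bool)), 'p topology, 'p \<Rightarrow> 'p) functr" where
  "point_functor = \<lparr>on_obj = point_space,
    on_hom = (\<lambda>M N h. restrict (code M \<circ> snd h \<circ> decode N) (topspace (point_space N)))\<rparr>"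

lemma obj_dzBooleD:
  assumes "M \<in> obj (dzBoole U)"
  shows "dz_algebra (fst M, snd M)" "z_algebra (fst M, snd M)" "bool_alg (fst M)"
    "snd M \<subseteq> Boole (fst M) two" "small U (snd M)"
  using assms by (auto simp: dzBoole_def dz_algebra_def z_algebra_def)

lemma topspace_stone_subspace: "M \<in> obj (dzBoole U) \<Longrightarrow> topspace (stone_subspace M) = snd M"
  unfolding stone_subspace_def by (intro topspace_subtopology_stone_space obj_dzBooleD)

text \<open>The size bound embeds \<open>snd M\<close> into a set over \<open>'p\<close>, so the
  choice made in \<open>code\<close> has a witness.\<close>

lemma inj_on_code:
  fixes M :: "'a zalg" and U :: "'p set set"
  assumes "M \<in> obj (dzBoole U)"
  shows "inj_on (code M :: _ \<Rightarrow> 'p) (snd M)"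
proof -
  obtain e :: "('a \<Rightarrow> bool) \<Rightarrow> 'p" where "inj_on e (snd M)"
    using obj_dzBooleD(5) [OF assms] unfolding small_def lepoll_def by blast
  then show ?thesis
    unfolding code_def by (rule someI [where P = "\<lambda>e. inj_on e (snd M)"])
qed

lemma homeomorphic_maps_code:
  fixes M :: "'a zalg" and U :: "'p set set"
  assumes "M \<in> obj (dzBoole U)"
  shows "homeomorphic_maps (stone_subspace M) (point_space M :: 'p topology) (code M) (decode M)"
  using homeomorphic_maps_pullback_topology [of "code M :: _ \<Rightarrow> 'p" "stone_subspace M"] inj_on_code [OF assms]
  by (simp add: point_space_def decode_def topspace_stone_subspace [OF assms])

lemma code_decode:
  fixes M :: "'a zalg" and U :: "'p set set"
  assumes "M \<in> obj (dzBoole U)"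
  shows "topspace (point_space M :: 'p topology) = code M ` snd M"
    and "x \<in> snd M \<Longrightarrow> decode M (code M x :: 'p) = x"
proof -
  show "x \<in> snd M \<Longrightarrow> decode M (code M x :: 'p) = x"
    using inj_on_code [OF assms] by (simp add: decode_def)
  show "topspace (point_space M :: 'p topology) = code M ` snd M"
    using homeomorphic_imp_surjective_map [OF homeomorphic_maps_imp_map [OF homeomorphic_maps_code [OF assms]]]
    by (simp add: topspace_stone_subspace [OF assms])
qed

section \<open>Morphisms of dz-algebras as continuous maps\<close>

lemma hom_dzBoole_iff:
  fixes M N :: "'a zalg" and U :: "'p set set"
  assumes M: "M \<in> obj (dzBoole U)" and N: "N \<in> obj (dzBoole U)"
  shows "h \<in> hom (dzBoole U) M N \<longleftrightarrow>
    fst h \<in> Boole (fst M) (fst N) \<and> snd h \<in> snd N \<rightarrow>\<^sub>E snd M \<and>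
    (\<forall>y\<in>snd N. \<forall>a\<in>carr (fst M). y (fst h a) = snd h y a)"
proof -
  \<comment> \<open>Both functions are extensional on \<open>carr (fst M)\<close>, so their equality
    amounts to equality at each element of the algebra.\<close>
  have dual: "compose (carr (fst M)) y \<phi> = f y \<longleftrightarrow> (\<forall>a\<in>carr (fst M). y (\<phi> a) = f y a)"
    if "f \<in> snd N \<rightarrow>\<^sub>E snd M" "y \<in> snd N" for f y and \<phi> :: "'a \<Rightarrow> 'a"
  proof -
    have "f y \<in> Boole (fst M) two"
      using that obj_dzBooleD(4) [OF M] by auto
    then have ext: "f y \<in> extensional (carr (fst M))"
      by (auto simp: Boole_def PiE_def)
    show ?thesis
    proof
      assume "compose (carr (fst M)) y \<phi> = f y"
      from fun_cong [OF this] show "\<forall>a\<in>carr (fst M). y (\<phi> a) = f y a"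
        using compose_eq [of _ "carr (fst M)" y \<phi>] by (intro ballI) (rule trans [OF sym])
    next
      assume "\<forall>a\<in>carr (fst M). y (\<phi> a) = f y a"
      then show "compose (carr (fst M)) y \<phi> = f y"
        by (intro extensionalityI [OF compose_extensional ext]) (simp add: compose_eq)
    qed
  qed
  have "h \<in> hom (dzBoole U) M N \<longleftrightarrow>
      fst h \<in> Boole (fst M) (fst N) \<and> snd h \<in> snd N \<rightarrow>\<^sub>E snd M \<and>
      (\<forall>y\<in>snd N. compose (carr (fst M)) y (fst h) = snd h y)"
    by (cases M; cases N; cases h) (simp add: dzBoole_def)
  also have "\<dots> \<longleftrightarrow> fst h \<in> Boole (fst M) (fst N) \<and> snd h \<in> snd N \<rightarrow>\<^sub>E snd M \<and>
      (\<forall>y\<in>snd N. \<forall>a\<in>carr (fst M). y (fst h a) = snd h y a)"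
    by (intro conj_cong refl ball_cong dual; assumption)
  finally show ?thesis .
qed

lemma hom_dzBooleD:
  fixes M N :: "'a zalg" and U :: "'p set set"
  assumes M: "M \<in> obj (dzBoole U)" and N: "N \<in> obj (dzBoole U)" and h: "h \<in> hom (dzBoole U) M N"
  shows "fst h \<in> Boole (fst M) (fst N)" "fst h \<in> carr (fst M) \<rightarrow>\<^sub>E carr (fst N)"
    "snd h \<in> snd N \<rightarrow>\<^sub>E snd M"
    "\<lbrakk>y \<in> snd N; a \<in> carr (fst M)\<rbrakk> \<Longrightarrow> y (fst h a) = snd h y a"
proof -
  note * = iffD1 [OF hom_dzBoole_iff [OF M N] h]
  show "fst h \<in> Boole (fst M) (fst N)"
    by (rule conjunct1 [OF *])
  then show "fst h \<in> carr (fst M) \<rightarrow>\<^sub>E carr (fst N)"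
    by (simp add: Boole_def)
  show "snd h \<in> snd N \<rightarrow>\<^sub>E snd M"
    by (rule conjunct1 [OF conjunct2 [OF *]])
  show "y (fst h a) = snd h y a" if "y \<in> snd N" "a \<in> carr (fst M)"
    by (rule bspec [OF bspec [OF conjunct2 [OF conjunct2 [OF *]] that(1)] that(2)])
qed

text \<open>The second component determines the first because the points of \<open>N\<close>
  separate elements. It is continuous because the preimage of the basic set of \<open>a\<close> is
  the basic set of \<open>fst h a\<close>. Conversely, every continuous map has a dual
  homomorphism.\<close>

lemma bij_betw_snd_hom_dzBoole:
  fixes M N :: "'a zalg" and U :: "'p set set"
  assumes M: "M \<in> obj (dzBoole U)" and N: "N \<in> obj (dzBoole U)"
  shows "bij_betw snd (hom (dzBoole U) M N)
    {f \<in> extensional (topspace (stone_subspace N)). continuous_map (stone_subspace N) (stone_subspace M) f}"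
  unfolding bij_betw_def
proof (intro conjI subset_antisym subsetI)
  note MD = obj_dzBooleD [OF M] and ND = obj_dzBooleD [OF N]
  note top = topspace_stone_subspace [OF N] topspace_stone_subspace [OF M]
  note cont = continuous_map_into_stone_space_iff [OF MD(3,4), folded stone_subspace_def]
  show "inj_on snd (hom (dzBoole U) M N)"
  proof (rule inj_onI)
    fix h k assume hk: "h \<in> hom (dzBoole U) M N" "k \<in> hom (dzBoole U) M N" "snd h = snd k"
    have "fst h = fst k"
      using hom_dzBooleD(2) [OF M N hk(1)] hom_dzBooleD(2) [OF M N hk(2)]
    proof (rule dual_unique [OF ND(2)])
      fix a y assume "a \<in> carr (fst M)" "y \<in> snd N"
      then show "y (fst h a) = y (fst k a)"
        using hom_dzBooleD(4) [OF M N hk(1), of y a] hom_dzBooleD(4) [OF M N hk(2), of y a] hk(3)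
        by simp
    qed
    with hk(3) show "h = k" by (simp add: prod_eq_iff)
  qed
  show "f \<in> {f \<in> extensional (topspace (stone_subspace N)).
      continuous_map (stone_subspace N) (stone_subspace M) f}" if f_in: "f \<in> snd ` hom (dzBoole U) M N" for f
  proof -
    obtain h where hom: "h \<in> hom (dzBoole U) M N" and f: "f = snd h"
      using f_in by blast
    note h = hom_dzBooleD [OF M N hom, folded f]
    have "openin (stone_subspace N) {y \<in> snd N. f y a}" if a: "a \<in> carr (fst M)" for a
    proof -
      have "fst h a \<in> carr (fst N)"
        using h(2) a by auto
      then have "openin (stone_subspace N) (snd N \<inter> stone_set (fst N) (fst h a))"
        using stone_set_in_CO [OF ND(3,4)] by (simp add: stone_subspace_def CO_def)
      moreover have "snd N \<inter> stone_set (fst N) (fst h a) = {y \<in> snd N. f y a}"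
      proof (intro set_eqI iffI)
        fix y
        show "y \<in> {y \<in> snd N. f y a}" if "y \<in> snd N \<inter> stone_set (fst N) (fst h a)"
          using that h(4) [of y a] a by (simp add: stone_set_def two_def)
        show "y \<in> snd N \<inter> stone_set (fst N) (fst h a)" if "y \<in> {y \<in> snd N. f y a}"
          using that h(4) [of y a] a ND(4) by (auto simp: stone_set_def two_def)
      qed
      ultimately show ?thesis by simp
    qed
    then show ?thesis
      using h(3) by (simp add: cont top PiE_def)
  qed
  show "f \<in> snd ` hom (dzBoole U) M N" if f: "f \<in> {f \<in> extensional (topspace (stone_subspace N)).
      continuous_map (stone_subspace N) (stone_subspace M) f}" for f
  proof -
    have cf: "continuous_map (stone_subspace N) (stone_subspace M) f" and fE: "f \<in> snd N \<rightarrow>\<^sub>E snd M"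
      using f continuous_map_funspace [of "stone_subspace N" "stone_subspace M" f]
      by (simp_all add: top PiE_def)
    obtain \<phi> where \<phi>: "\<phi> \<in> Boole (fst M) (fst N)"
        "\<And>a y. a \<in> carr (fst M) \<Longrightarrow> y \<in> snd N \<Longrightarrow> y (\<phi> a) = f y a"
      using dual_exists [OF MD(3,4) ND(1) cf [unfolded stone_subspace_def]] by blast
    then have "(\<phi>, f) \<in> hom (dzBoole U) M N"
      unfolding hom_dzBoole_iff [OF M N] using fE by (simp add: \<phi>)
    then show ?thesis
      by (metis image_eqI snd_conv)
  qed
qed

text \<open>The functor acts on morphisms as two successive bijections: passing to the second
  component, then conjugating by the codings of the two spaces.\<close>

lemma point_functor_fully_faithful:
  fixes M N :: "'a zalg" and U :: "'p set set"
  assumes M: "M \<in> obj (dzBoole U)" and N: "N \<in> obj (dzBoole U)"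
  shows "bij_betw (on_hom point_functor M N) (hom (dzBoole U) M N)
    (hom (ZHaus U) (point_space N) (point_space M))"
  using bij_betw_trans [OF bij_betw_snd_hom_dzBoole [OF M N]
      bij_betw_continuous_maps [OF homeomorphic_maps_code [OF N] homeomorphic_maps_code [OF M]]]
  by (simp add: point_functor_def ZHaus_def o_def)

lemma contravariant_point_functor:
  "contravariant_functor (dzBoole U :: ('a zalg, _) cat) (ZHaus U) (point_functor :: (_, _, 'p topology, _) functr)"
proof
  fix M :: "'a zalg" assume M: "M \<in> obj (dzBoole U)"
  have "small U (code M ` snd M :: 'p set)"
    using obj_dzBooleD(5) [OF M] image_lepoll by (rule small_lepoll)
  moreover have "zero_dimensional_Hausdorff (point_space M :: 'p topology)"
    using homeomorphic_maps_code [OF M]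
    by (rule homeomorphic_maps_zero_dimensional_Hausdorff)
      (simp add: stone_subspace_def obj_dzBooleD [OF M] zero_dimensional_Hausdorff_subtopology_stone_space)
  ultimately show "on_obj point_functor M \<in> obj (ZHaus U)"
    by (simp add: point_functor_def ZHaus_def code_decode [OF M])
  have "snd (ident (dzBoole U) M) = restrict id (snd M)"
    by (simp add: dzBoole_def split: prod.split)
  then show "on_hom point_functor M M (ident (dzBoole U) M) = ident (ZHaus U) (on_obj point_functor M)"
    by (auto simp: point_functor_def ZHaus_def code_decode [OF M] intro!: restrict_ext)
next
  fix M N :: "'a zalg" and h assume "M \<in> obj (dzBoole U)" "N \<in> obj (dzBoole U)" "h \<in> hom (dzBoole U) M N"
  then show "on_hom point_functor M N h \<in> hom (ZHaus U) (on_obj point_functor N) (on_obj point_functor M)"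
    using bij_betwE [OF point_functor_fully_faithful [of M U N]] by (simp add: point_functor_def)
next
  fix M N P :: "'a zalg" and h k
  assume MNP: "M \<in> obj (dzBoole U)" "N \<in> obj (dzBoole U)" "P \<in> obj (dzBoole U)"
    and h: "h \<in> hom (dzBoole U) M N" and k: "k \<in> hom (dzBoole U) N P"
  have snd_cmp: "snd (cmp (dzBoole U) M N P k h) = compose (snd P) (snd h) (snd k)"
    by (simp add: dzBoole_def split: prod.split)
  \<comment> \<open>This lets the coding after \<open>k\<close> cancel against the decoding before
    \<open>h\<close>.\<close>
  have "snd k y \<in> snd N" if "y \<in> snd P" for y
    using hom_dzBooleD(3) [OF MNP(2,3) k] that by auto
  then show "on_hom point_functor M P (cmp (dzBoole U) M N P k h) =
      cmp (ZHaus U) (on_obj point_functor P) (on_obj point_functor N) (on_obj point_functor M)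
       (on_hom point_functor M N h) (on_hom point_functor N P k)"
    by (auto simp: point_functor_def ZHaus_def snd_cmp compose_def
        code_decode [OF MNP(2)] code_decode [OF MNP(3)] intro!: restrict_ext)
qed

lemma point_functor_essentially_surjective:
  fixes U :: "'p set set" and Z :: "'p topology"
  assumes U: "\<And>T. T \<in> U \<Longrightarrow> Pow T \<lesssim> (UNIV :: 'a set)" and Z: "Z \<in> obj (ZHaus U)"
  shows "\<exists>M\<in>obj (dzBoole U :: ('a zalg, _) cat). \<exists>e. iso_in (ZHaus U) (point_space M) Z e"
proof -
  have zd: "zero_dimensional_Hausdorff Z" and small: "small U (topspace Z)"
    using Z by (simp_all add: ZHaus_def)
  obtain T where T: "T \<in> U" "topspace Z \<lesssim> T"
    using small by (auto simp: small_def)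
  \<comment> \<open>The size hypothesis makes room in \<open>'a\<close> for a code of every clopen
    set of \<open>Z\<close>.\<close>
  have "CO Z \<lesssim> Pow (topspace Z)"
    by (intro subset_imp_lepoll subsetI PowI CO_subset)
  also have "Pow (topspace Z) \<lesssim> Pow T"
    using T(2) by (rule lepoll_Pow_mono)
  also have "Pow T \<lesssim> (UNIV :: 'a set)"
    using T(1) by (rule U)
  finally obtain i :: "'p set \<Rightarrow> 'a" where i: "inj_on i (CO Z)"
    by (auto simp: lepoll_def)
  let ?p = "clopen_point i Z"
  let ?M = "(clopen_algebra i Z, ?p ` topspace Z)"
  have M: "?M \<in> obj (dzBoole U)"
    using dz_algebra_clopen_algebra [OF zd i] small_lepoll [OF small image_lepoll [of ?p]]
    by (simp add: dzBoole_def)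
  obtain q where "homeomorphic_maps Z (stone_subspace ?M) ?p q"
    using homeomorphic_map_clopen_point [OF zd i]
    unfolding homeomorphic_map_maps stone_subspace_def fst_conv snd_conv by blast
  \<comment> \<open>\<open>Z\<close> is identified with the Stone subspace of its clopen algebra and
    then with the coded copy; the composite is turned round to start at the copy.\<close>
  from homeomorphic_maps_compose [OF conjI [OF this homeomorphic_maps_code [OF M]]]
  have "homeomorphic_maps (point_space ?M :: 'p topology) Z (q \<circ> decode ?M) (code ?M \<circ> ?p)"
    by (rule iffD1 [OF homeomorphic_maps_sym])
  from iso_in_ZHaus [OF this] M show ?thesis
    by (intro bexI exI)
qed

text \<open>The functor constructed runs from dz-algebras to spaces, hence the appeal to symmetry of
  dual equivalence. The size hypothesis serves essential surjectivity.\<close>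

theorem theorem3p15:
  fixes U :: "'p set set"
  assumes "\<And>T. T \<in> U \<Longrightarrow> Pow T \<lesssim> (UNIV :: 'a set)"
  shows "dually_equivalent (ZHaus U :: ('p topology, 'p \<Rightarrow> 'p) cat)
    (dzBoole U :: ('a zalg, ('a \<Rightarrow> 'a) \<times> (('a \<Rightarrow> bool) \<Rightarrow> ('a \<Rightarrow> bool))) cat)"
proof (rule dually_equivalent_sym,
    rule dually_equivalent_if_fully_faithful [OF category_dzBoole category_ZHaus
      contravariant_point_functor])
  fix M N :: "'a zalg" assume "M \<in> obj (dzBoole U)" "N \<in> obj (dzBoole U)"
  then show "bij_betw (on_hom point_functor M N) (hom (dzBoole U) M N)
      (hom (ZHaus U) (on_obj point_functor N) (on_obj point_functor M))"
    using point_functor_fully_faithful [of M U N] by (simp add: point_functor_def)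
next
  fix Z :: "'p topology" assume "Z \<in> obj (ZHaus U)"
  from point_functor_essentially_surjective [OF assms this]
  show "\<exists>M\<in>obj (dzBoole U :: ('a zalg, _) cat). \<exists>e. iso_in (ZHaus U) (on_obj point_functor M) Z e"
    by (simp add: point_functor_def)
qed

end
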